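(* Let $S$ be a zerosumfree semiring and let $X_1,X_2,\ldots,X_n$ be indeterminates over $S$. Then $U(S[[X_1,X_2,\ldots,X_n]]) = U(S)$.
   Context: A semiring is a set $S$ with operations $+,\cdot$ such that $(S,+,0)$ and $(S,\cdot,1)$ are commutative monoids with $1\neq 0$, multiplication distributes over addition, and $s\cdot 0=0$ for all $s$. $S$ is zerosumfree if $a+b=0$ implies $a=b=0$ for all $a,b\in S$. $U(T)$ denotes the set of units of a semiring $T$, i.e. elements $s$ with $st=1$ for some $t\in T$. $S[[X_1,\ldots,X_n]]$ is the semiring of formal power series, and $S$ is identified with the constant power series. *)

theory Defs
  imports "HOL-Algebra.Ring"
begin

locale csemiring = semiring S + comm_monoid S for S (structure) +
  assumes one_not_zero: "\<one> \<noteq> \<zero>"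

locale zerosumfree_semiring = csemiring +
  assumes zerosumfree:
    "\<lbrakk>a \<in> carrier S; b \<in> carrier S; a \<oplus> b = \<zero>\<rbrakk> \<Longrightarrow> a = \<zero> \<and> b = \<zero>"

text \<open>The monomial \<open>X\<^sub>1\<^bsup>a 1\<^esup> \<cdots> X\<^sub>n\<^bsup>a n\<^esup>\<close> is encoded by its exponent function \<open>a\<close>,
  set to \<open>0\<close> outside \<open>{1..n}\<close> so that distinct functions are distinct monomials.\<close>

definition mexps :: "nat \<Rightarrow> (nat \<Rightarrow> nat) set" where
  "mexps n = {a. \<forall>i. i \<notin> {1..n} \<longrightarrow> a i = 0}"

definition msplits :: "nat \<Rightarrow> (nat \<Rightarrow> nat) \<Rightarrow> ((nat \<Rightarrow> nat) \<times> (nat \<Rightarrow> nat)) set" where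
  "msplits n a = {(b, c). b \<in> mexps n \<and> c \<in> mexps n \<and> (\<lambda>i. b i + c i) = a}"

definition mps_const :: "('a, 'm) ring_scheme \<Rightarrow> nat \<Rightarrow> 'a \<Rightarrow> (nat \<Rightarrow> nat) \<Rightarrow> 'a" where
  "mps_const S n s = (\<lambda>a\<in>mexps n. if a = (\<lambda>_. 0) then s else \<zero>\<^bsub>S\<^esub>)"

text \<open>\<open>S[[X\<^sub>1,\<dots>,X\<^sub>n]]\<close>: a power series is its coefficient function on the monomials. The sum in
  the Cauchy product is finite by \<open>finite_msplits\<close> below.\<close>

definition mps :: "('a, 'm) ring_scheme \<Rightarrow> nat \<Rightarrow> ((nat \<Rightarrow> nat) \<Rightarrow> 'a) ring" where
  "mps S n =
    \<lparr>carrier = mexps n \<rightarrow>\<^sub>E carrier S,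
     monoid.mult = (\<lambda>f g. \<lambda>a\<in>mexps n.
       \<Oplus>\<^bsub>S\<^esub>p\<in>msplits n a. f (fst p) \<otimes>\<^bsub>S\<^esub> g (snd p)),
     one = mps_const S n \<one>\<^bsub>S\<^esub>,
     zero = mps_const S n \<zero>\<^bsub>S\<^esub>,
     add = (\<lambda>f g. \<lambda>a\<in>mexps n. f a \<oplus>\<^bsub>S\<^esub> g a)\<rparr>"

lemma finite_msplits: "finite (msplits n a)"
proof -
  let ?A = "{b. \<forall>i. (i \<in> {1..n} \<longrightarrow> b i \<in> {..Max (a ` {1..n})}) \<and> (i \<notin> {1..n} \<longrightarrow> b i = 0)}"
  have fin: "finite ?A"
    by (rule finite_set_of_finite_funs) auto
  have le: "a i \<le> Max (a ` {1..n})" if "i \<in> {1..n}" for i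
    using that by (intro Max_ge) auto
  have "msplits n a \<subseteq> ?A \<times> ?A"
  proof
    fix p assume "p \<in> msplits n a"
    then obtain b c where p: "p = (b, c)" "b \<in> mexps n" "c \<in> mexps n" "\<And>i. b i + c i = a i"
      by (auto simp: msplits_def fun_eq_iff)
    have "b i \<le> Max (a ` {1..n}) \<and> c i \<le> Max (a ` {1..n})" if "i \<in> {1..n}" for i
      using le[OF that] p(4)[of i] by linarith
    then show "p \<in> ?A \<times> ?A"
      using p(1-3) by (auto simp: mexps_def)
  qed
  then show ?thesis
    using fin by (meson finite_SigmaI finite_subset)
qed

lemma msplitsD:
  "(b, c) \<in> msplits n a \<Longrightarrow> b \<in> mexps n \<and> c \<in> mexps n"
  by (auto simp: msplits_def)

lemma zero_mexps [simp]: "(\<lambda>_. 0) \<in> mexps n"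
  by (simp add: mexps_def)

lemma add_mexps [simp]: "a \<in> mexps n \<Longrightarrow> b \<in> mexps n \<Longrightarrow> (\<lambda>i. a i + b i) \<in> mexps n"
  by (simp add: mexps_def)

lemma (in abelian_monoid) finsum_Sigma_eq:
  assumes "finite A" "\<And>x. x \<in> A \<Longrightarrow> finite (B x)"
    "\<And>x y. x \<in> A \<Longrightarrow> y \<in> B x \<Longrightarrow> f x y \<in> carrier G"
  shows "(\<Oplus>x\<in>A. \<Oplus>y\<in>B x. f x y) = (\<Oplus>p\<in>Sigma A B. f (fst p) (snd p))"
  using assms
proof (induction A rule: finite_induct)
  case empty
  then show ?case by simp
next
  case (insert x A)
  have S: "Sigma (insert x A) B = Pair x ` B x \<union> Sigma A B"
    by auto
  have "(\<Oplus>p\<in>Sigma (insert x A) B. f (fst p) (snd p))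
      = (\<Oplus>p\<in>Pair x ` B x. f (fst p) (snd p)) \<oplus> (\<Oplus>p\<in>Sigma A B. f (fst p) (snd p))"
    unfolding S by (rule finsum_Un_disjoint) (use insert in \<open>auto intro!: finite_SigmaI\<close>)
  also have "(\<Oplus>p\<in>Pair x ` B x. f (fst p) (snd p)) = (\<Oplus>y\<in>B x. f x y)"
    by (subst finsum_reindex) (use insert in \<open>auto simp: inj_on_def\<close>)
  also have "(\<Oplus>p\<in>Sigma A B. f (fst p) (snd p)) = (\<Oplus>x\<in>A. \<Oplus>y\<in>B x. f x y)"
    using insert by simp
  finally show ?case
    using insert by (subst finsum_insert) (auto intro!: finsum_closed)
qed

context csemiring
begin

lemma mps_coeff [simp]:
  "f \<in> carrier (mps S n) \<Longrightarrow> a \<in> mexps n \<Longrightarrow> f a \<in> carrier S"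
  by (auto simp: mps_def)

lemma mps_eqI:
  assumes "f \<in> carrier (mps S n)" "g \<in> carrier (mps S n)" "\<And>a. a \<in> mexps n \<Longrightarrow> f a = g a"
  shows "f = g"
  using assms by (auto simp: mps_def intro: PiE_ext)

lemma mps_const_closed [simp]: "s \<in> carrier S \<Longrightarrow> mps_const S n s \<in> carrier (mps S n)"
  by (auto simp: mps_def mps_const_def)

lemma mps_add_coeff:
  "a \<in> mexps n \<Longrightarrow> (f \<oplus>\<^bsub>mps S n\<^esub> g) a = f a \<oplus> g a"
  by (simp add: mps_def)

lemma mps_mult_coeff:
  "a \<in> mexps n \<Longrightarrow> (f \<otimes>\<^bsub>mps S n\<^esub> g) a = (\<Oplus>p\<in>msplits n a. f (fst p) \<otimes> g (snd p))"
  by (simp add: mps_def)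

lemma mps_zero: "\<zero>\<^bsub>mps S n\<^esub> = mps_const S n \<zero>"
  by (simp add: mps_def)

lemma mps_one: "\<one>\<^bsub>mps S n\<^esub> = mps_const S n \<one>"
  by (simp add: mps_def)

lemma mps_const_coeff:
  "a \<in> mexps n \<Longrightarrow> mps_const S n s a = (if a = (\<lambda>_. 0) then s else \<zero>)"
  by (simp add: mps_const_def)

lemma mps_add_closed:
  "f \<in> carrier (mps S n) \<Longrightarrow> g \<in> carrier (mps S n) \<Longrightarrow> f \<oplus>\<^bsub>mps S n\<^esub> g \<in> carrier (mps S n)"
  by (auto simp: mps_def)

lemma mps_mult_closed:
  "f \<in> carrier (mps S n) \<Longrightarrow> g \<in> carrier (mps S n) \<Longrightarrow> f \<otimes>\<^bsub>mps S n\<^esub> g \<in> carrier (mps S n)"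
  by (auto simp: mps_def dest: msplitsD intro!: finsum_closed)

lemma mps_mult_comm:
  assumes "f \<in> carrier (mps S n)" "g \<in> carrier (mps S n)"
  shows "f \<otimes>\<^bsub>mps S n\<^esub> g = g \<otimes>\<^bsub>mps S n\<^esub> f"
proof (rule mps_eqI[OF mps_mult_closed mps_mult_closed])
  fix a assume a: "a \<in> mexps n"
  have sw: "prod.swap ` msplits n a = msplits n a"
    by (force simp: msplits_def add.commute)
  have "(\<Oplus>p\<in>prod.swap ` msplits n a. g (fst p) \<otimes> f (snd p))
      = (\<Oplus>p\<in>msplits n a. g (fst (prod.swap p)) \<otimes> f (snd (prod.swap p)))"
    by (rule finsum_reindex) (use assms in \<open>auto dest: msplitsD\<close>)
  also have "\<dots> = (\<Oplus>p\<in>msplits n a. f (fst p) \<otimes> g (snd p))"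
    by (rule finsum_cong') (use assms in \<open>auto dest: msplitsD simp: m_comm\<close>)
  finally show "(f \<otimes>\<^bsub>mps S n\<^esub> g) a = (g \<otimes>\<^bsub>mps S n\<^esub> f) a"
    using a by (simp add: mps_mult_coeff sw)
qed (use assms in auto)

lemma mps_const_mult_coeff:
  assumes "s \<in> carrier S" "f \<in> carrier (mps S n)" "a \<in> mexps n"
  shows "(mps_const S n s \<otimes>\<^bsub>mps S n\<^esub> f) a = s \<otimes> f a"
proof -
  have "(\<Oplus>p\<in>msplits n a. mps_const S n s (fst p) \<otimes> f (snd p))
      = (\<Oplus>p\<in>msplits n a. if ((\<lambda>_. 0), a) = p then s \<otimes> f (snd p) else \<zero>)"
  proof (rule finsum_cong'[OF refl])
    fix p assume "p \<in> msplits n a"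
    then obtain b c where p: "p = (b, c)" "b \<in> mexps n" "c \<in> mexps n" "a = (\<lambda>i. b i + c i)"
      by (auto simp: msplits_def)
    show "mps_const S n s (fst p) \<otimes> f (snd p)
        = (if ((\<lambda>_. 0), a) = p then s \<otimes> f (snd p) else \<zero>)"
      by (cases "b = (\<lambda>_. 0)") (use p assms in \<open>auto simp: mps_const_coeff\<close>)
  qed (use assms in \<open>auto dest: msplitsD\<close>)
  also have "\<dots> = s \<otimes> f (snd ((\<lambda>_::nat. 0::nat), a))"
  proof (rule finsum_singleton[of "((\<lambda>_. 0), a)" "msplits n a" "\<lambda>p. s \<otimes> f (snd p)"])
    show "((\<lambda>_. 0), a) \<in> msplits n a"
      using assms by (simp add: msplits_def)
    show "(\<lambda>p. s \<otimes> f (snd p)) \<in> msplits n a \<rightarrow> carrier S"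
      using assms by (auto dest: msplitsD)
  qed (rule finite_msplits)
  finally show ?thesis
    using assms by (simp add: mps_mult_coeff)
qed

lemma mps_mult_assoc:
  assumes f: "f \<in> carrier (mps S n)" and g: "g \<in> carrier (mps S n)" and h: "h \<in> carrier (mps S n)"
  shows "(f \<otimes>\<^bsub>mps S n\<^esub> g) \<otimes>\<^bsub>mps S n\<^esub> h = f \<otimes>\<^bsub>mps S n\<^esub> (g \<otimes>\<^bsub>mps S n\<^esub> h)"
proof (rule mps_eqI)
  fix a assume a: "a \<in> mexps n"
  let ?D = "msplits n"
  let ?L = "Sigma (?D a) (\<lambda>p. ?D (fst p))" and ?R = "Sigma (?D a) (\<lambda>p. ?D (snd p))"
  let ?\<phi> = "\<lambda>((u :: nat \<Rightarrow> nat, c :: nat \<Rightarrow> nat), (b :: nat \<Rightarrow> nat, d :: nat \<Rightarrow> nat)).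
    ((b, (\<lambda>i. d i + c i)), (d, c))"
  let ?F = "\<lambda>p q. f (fst p) \<otimes> (g (fst q) \<otimes> h (snd q))"
  have "((f \<otimes>\<^bsub>mps S n\<^esub> g) \<otimes>\<^bsub>mps S n\<^esub> h) a
      = (\<Oplus>p\<in>?D a. (\<Oplus>q\<in>?D (fst p). f (fst q) \<otimes> g (snd q)) \<otimes> h (snd p))"
    unfolding mps_mult_coeff[OF a]
    by (rule finsum_cong')
      (use assms in \<open>auto dest: msplitsD simp: mps_mult_coeff intro!: m_closed finsum_closed\<close>)
  also have "\<dots> = (\<Oplus>p\<in>?D a. \<Oplus>q\<in>?D (fst p). f (fst q) \<otimes> g (snd q) \<otimes> h (snd p))"
    by (rule finsum_cong')
      (use assms in \<open>auto dest: msplitsD simp: finite_msplits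
          intro!: finsum_ldistr m_closed finsum_closed\<close>)
  also have "\<dots> = (\<Oplus>r\<in>?L. f (fst (snd r)) \<otimes> g (snd (snd r)) \<otimes> h (snd (fst r)))"
    by (rule finsum_Sigma_eq)
      (use assms in \<open>auto dest: msplitsD simp: finite_msplits intro!: m_closed\<close>)
  also have "\<dots> = (\<Oplus>r\<in>?L. ?F (fst (?\<phi> r)) (snd (?\<phi> r)))"
    by (rule finsum_cong') (use assms in \<open>auto dest!: msplitsD simp: m_assoc\<close>)
  also have "\<dots> = (\<Oplus>r\<in>?\<phi> ` ?L. ?F (fst r) (snd r))"
    by (rule finsum_reindex[symmetric])
      (use assms in \<open>auto dest!: msplitsD simp: inj_on_def msplits_def\<close>)
  also have "?\<phi> ` ?L = ?R"
  proof
    show "?\<phi> ` ?L \<subseteq> ?R"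
      by (auto simp: msplits_def add.assoc)
    show "?R \<subseteq> ?\<phi> ` ?L"
    proof
      fix r assume r: "r \<in> ?R"
      obtain b v d c where rr: "r = ((b, v), (d, c))"
        by (metis surj_pair)
      have "(((\<lambda>i. b i + d i), c), (b, d)) \<in> ?L" "v = (\<lambda>i. d i + c i)"
        using r by (auto simp: rr msplits_def add.assoc)
      then show "r \<in> ?\<phi> ` ?L"
        by (force simp: rr)
    qed
  qed
  also have "(\<Oplus>r\<in>?R. ?F (fst r) (snd r)) = (\<Oplus>p\<in>?D a. \<Oplus>q\<in>?D (snd p). ?F p q)"
    by (rule finsum_Sigma_eq[symmetric])
      (use assms in \<open>auto dest: msplitsD simp: finite_msplits intro!: m_closed\<close>)
  also have "\<dots> = (\<Oplus>p\<in>?D a. f (fst p) \<otimes> (\<Oplus>q\<in>?D (snd p). g (fst q) \<otimes> h (snd q)))"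
    by (rule finsum_cong')
      (use assms in \<open>auto dest: msplitsD simp: finite_msplits
          intro!: finsum_rdistr[symmetric] m_closed finsum_closed\<close>)
  also have "\<dots> = (f \<otimes>\<^bsub>mps S n\<^esub> (g \<otimes>\<^bsub>mps S n\<^esub> h)) a"
    unfolding mps_mult_coeff[OF a]
    by (rule finsum_cong')
      (use assms in \<open>auto dest: msplitsD simp: mps_mult_coeff 
          intro!: m_closed mps_coeff[OF mps_mult_closed[OF g h]]\<close>)
  finally show "((f \<otimes>\<^bsub>mps S n\<^esub> g) \<otimes>\<^bsub>mps S n\<^esub> h) a = (f \<otimes>\<^bsub>mps S n\<^esub> (g \<otimes>\<^bsub>mps S n\<^esub> h)) a" .
qed (use assms in \<open>auto intro!: mps_mult_closed\<close>)

lemma mps_distr: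
  assumes "f \<in> carrier (mps S n)" "g \<in> carrier (mps S n)" "h \<in> carrier (mps S n)"
  shows "(f \<oplus>\<^bsub>mps S n\<^esub> g) \<otimes>\<^bsub>mps S n\<^esub> h
    = (f \<otimes>\<^bsub>mps S n\<^esub> h) \<oplus>\<^bsub>mps S n\<^esub> (g \<otimes>\<^bsub>mps S n\<^esub> h)"
proof (rule mps_eqI)
  fix a assume a: "a \<in> mexps n"
  have "(\<Oplus>p\<in>msplits n a. (f \<oplus>\<^bsub>mps S n\<^esub> g) (fst p) \<otimes> h (snd p))
      = (\<Oplus>p\<in>msplits n a. f (fst p) \<otimes> h (snd p) \<oplus> g (fst p) \<otimes> h (snd p))"
    by (rule finsum_cong') (use assms in \<open>auto dest: msplitsD simp: mps_add_coeff l_distr\<close>)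
  also have "\<dots> = (\<Oplus>p\<in>msplits n a. f (fst p) \<otimes> h (snd p))
      \<oplus> (\<Oplus>p\<in>msplits n a. g (fst p) \<otimes> h (snd p))"
    by (rule finsum_addf) (use assms in \<open>auto dest: msplitsD\<close>)
  finally show "((f \<oplus>\<^bsub>mps S n\<^esub> g) \<otimes>\<^bsub>mps S n\<^esub> h) a
    = ((f \<otimes>\<^bsub>mps S n\<^esub> h) \<oplus>\<^bsub>mps S n\<^esub> (g \<otimes>\<^bsub>mps S n\<^esub> h)) a"
    using a by (simp add: mps_add_coeff mps_mult_coeff)
qed (use assms in \<open>auto intro!: mps_mult_closed mps_add_closed\<close>)

lemma mps_null:
  assumes "f \<in> carrier (mps S n)"
  shows "\<zero>\<^bsub>mps S n\<^esub> \<otimes>\<^bsub>mps S n\<^esub> f = \<zero>\<^bsub>mps S n\<^esub>"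
  by (rule mps_eqI)
    (use assms in \<open>auto simp: mps_zero mps_const_mult_coeff mps_const_coeff intro!: mps_mult_closed\<close>)

lemma mps_l_one:
  assumes "f \<in> carrier (mps S n)"
  shows "\<one>\<^bsub>mps S n\<^esub> \<otimes>\<^bsub>mps S n\<^esub> f = f"
  by (rule mps_eqI)
    (use assms in \<open>auto simp: mps_one mps_const_mult_coeff intro!: mps_mult_closed\<close>)

lemma mps_abelian_monoid: "abelian_monoid (mps S n)"
proof (rule abelian_monoidI)
  fix f g h assume "f \<in> carrier (mps S n)" "g \<in> carrier (mps S n)" "h \<in> carrier (mps S n)"
  then show "(f \<oplus>\<^bsub>mps S n\<^esub> g) \<oplus>\<^bsub>mps S n\<^esub> h = f \<oplus>\<^bsub>mps S n\<^esub> (g \<oplus>\<^bsub>mps S n\<^esub> h)"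
    by (intro mps_eqI[of _ n]) (auto simp: mps_add_coeff a_assoc intro!: mps_add_closed)
next
  fix f g assume "f \<in> carrier (mps S n)" "g \<in> carrier (mps S n)"
  then show "f \<oplus>\<^bsub>mps S n\<^esub> g = g \<oplus>\<^bsub>mps S n\<^esub> f"
    by (intro mps_eqI[of _ n]) (auto simp: mps_add_coeff a_comm intro!: mps_add_closed)
next
  fix f assume "f \<in> carrier (mps S n)"
  then show "\<zero>\<^bsub>mps S n\<^esub> \<oplus>\<^bsub>mps S n\<^esub> f = f"
    by (intro mps_eqI[of _ n])
      (auto simp: mps_add_coeff mps_zero mps_const_coeff intro!: mps_add_closed)
qed (auto simp: mps_zero intro!: mps_add_closed)

lemma mps_comm_monoid: "comm_monoid (mps S n)"
  by (rule comm_monoidI)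
    (auto simp: mps_one mps_mult_assoc mps_l_one[unfolded mps_one]
      intro!: mps_mult_closed mps_mult_comm)

lemma inj_on_mps_const: "inj_on (mps_const S n) (carrier S)"
proof (rule inj_onI)
  fix s t assume "mps_const S n s = mps_const S n t"
  then have "mps_const S n s (\<lambda>_. 0) = mps_const S n t (\<lambda>_. 0)"
    by simp
  then show "s = t"
    by (simp add: mps_const_coeff)
qed

theorem mps_csemiring: "csemiring (mps S n)"
proof -
  interpret A: abelian_monoid "mps S n" by (rule mps_abelian_monoid)
  interpret M: comm_monoid "mps S n" by (rule mps_comm_monoid)
  show ?thesis
  proof unfold_locales
    fix f g h
    assume *: "f \<in> carrier (mps S n)" "g \<in> carrier (mps S n)" "h \<in> carrier (mps S n)"
    show "(f \<oplus>\<^bsub>mps S n\<^esub> g) \<otimes>\<^bsub>mps S n\<^esub> h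
      = f \<otimes>\<^bsub>mps S n\<^esub> h \<oplus>\<^bsub>mps S n\<^esub> g \<otimes>\<^bsub>mps S n\<^esub> h"
      using * by (rule mps_distr)
    then show "h \<otimes>\<^bsub>mps S n\<^esub> (f \<oplus>\<^bsub>mps S n\<^esub> g)
      = h \<otimes>\<^bsub>mps S n\<^esub> f \<oplus>\<^bsub>mps S n\<^esub> h \<otimes>\<^bsub>mps S n\<^esub> g"
      using * by (simp add: M.m_comm[of h])
  next
    fix f assume *: "f \<in> carrier (mps S n)"
    show "\<zero>\<^bsub>mps S n\<^esub> \<otimes>\<^bsub>mps S n\<^esub> f = \<zero>\<^bsub>mps S n\<^esub>"
      using * by (rule mps_null)
    then show "f \<otimes>\<^bsub>mps S n\<^esub> \<zero>\<^bsub>mps S n\<^esub> = \<zero>\<^bsub>mps S n\<^esub>"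
      using * by (simp add: M.m_comm[of f])
  next
    show "\<one>\<^bsub>mps S n\<^esub> \<noteq> \<zero>\<^bsub>mps S n\<^esub>"
      using inj_on_mps_const[of n] one_not_zero by (auto simp: mps_one mps_zero inj_on_def)
  qed
qed

lemma mps_const_hom: "mps_const S n \<in> ring_hom S (mps S n)"
proof (rule ring_hom_memI)
  fix s t assume *: "s \<in> carrier S" "t \<in> carrier S"
  show "mps_const S n (s \<otimes> t) = mps_const S n s \<otimes>\<^bsub>mps S n\<^esub> mps_const S n t"
    by (rule mps_eqI[of _ n])
      (use * in \<open>auto simp: mps_const_mult_coeff mps_const_coeff intro!: mps_mult_closed\<close>)
  show "mps_const S n (s \<oplus> t) = mps_const S n s \<oplus>\<^bsub>mps S n\<^esub> mps_const S n t"
    by (rule mps_eqI[of _ n])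
      (use * in \<open>auto simp: mps_add_coeff mps_const_coeff intro!: mps_add_closed\<close>)
qed (auto simp: mps_one)

end

end

theory Submission
  imports Defs
begin

text \<open>If \<open>f g = 1\<close>, comparing constant terms gives \<open>f\<^sub>0 g\<^sub>0 = 1\<close>. For a monomial \<open>a \<noteq> 0\<close> the
  coefficient of \<open>f g\<close> at \<open>a\<close> is a vanishing sum having \<open>f\<^sub>a g\<^sub>0\<close> as one of its terms, so
  \<open>f\<^sub>a g\<^sub>0 = 0\<close> because \<open>S\<close> is zerosumfree, and \<open>f\<^sub>a = 0\<close> because \<open>g\<^sub>0\<close> is a unit.\<close>

text \<open>Natural exponents cannot cancel, so \<open>b i + c i = 0\<close> forces both to vanish.
  Hence the constant term of a product has a single summand.\<close>

lemma msplits_zero: "msplits n (\<lambda>_. 0) = {((\<lambda>_. 0), (\<lambda>_. 0))}"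
  by (auto simp: msplits_def fun_eq_iff mexps_def)

text \<open>Isolating the summand at \<open>x\<close> writes zero as \<open>f x\<close> plus the sum
  of the remaining terms, so one application of \<open>zerosumfree\<close> suffices, without
  induction on \<open>A\<close>.\<close>

lemma (in zerosumfree_semiring) finsum_eq_zeroD:
  assumes "finite A" "f \<in> A \<rightarrow> carrier S" "finsum S f A = \<zero>" "x \<in> A"
  shows "f x = \<zero>"
proof -
  have "finsum S f (insert x (A - {x})) = f x \<oplus> finsum S f (A - {x})"
    by (rule finsum_insert) (use assms in auto)
  then have "f x \<oplus> finsum S f (A - {x}) = \<zero>"
    using assms by (simp add: insert_absorb)
  moreover have "f x \<in> carrier S" "finsum S f (A - {x}) \<in> carrier S"
    using assms by (auto intro!: finsum_closed)
  ultimately show ?thesis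
    using zerosumfree by blast
qed

lemma (in csemiring) mps_mult_coeff_zero:
  assumes "f \<in> carrier (mps S n)" "g \<in> carrier (mps S n)"
  shows "(f \<otimes>\<^bsub>mps S n\<^esub> g) (\<lambda>_. 0) = f (\<lambda>_. 0) \<otimes> g (\<lambda>_. 0)"
  using assms by (simp add: mps_mult_coeff msplits_zero finsum_insert)

lemma (in zerosumfree_semiring) mps_unit_is_const:
  assumes f: "f \<in> carrier (mps S n)" and g: "g \<in> carrier (mps S n)"
    and fg: "f \<otimes>\<^bsub>mps S n\<^esub> g = \<one>\<^bsub>mps S n\<^esub>"
  shows "f (\<lambda>_. 0) \<otimes> g (\<lambda>_. 0) = \<one>" and "f = mps_const S n (f (\<lambda>_. 0))"
proof -
  show fg0: "f (\<lambda>_. 0) \<otimes> g (\<lambda>_. 0) = \<one>"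
    using mps_mult_coeff_zero[OF f g] fg by (simp add: mps_one mps_const_coeff)
  have f0: "f (\<lambda>_. 0) \<in> carrier S" and g0: "g (\<lambda>_. 0) \<in> carrier S"
    using f g by simp_all
  have "f a = \<zero>" if a: "a \<in> mexps n" "a \<noteq> (\<lambda>_. 0)" for a
  proof -
    have fa: "f a \<in> carrier S"
      using f a by simp
    have "(\<Oplus>p\<in>msplits n a. f (fst p) \<otimes> g (snd p)) = \<zero>"
      using a fg by (simp add: mps_one mps_const_coeff flip: mps_mult_coeff)
    moreover have "(\<lambda>p. f (fst p) \<otimes> g (snd p)) \<in> msplits n a \<rightarrow> carrier S"
      using f g by (auto dest: msplitsD)
    \<comment> \<open>This split of \<open>a\<close> selects the summand in which \<open>g\<close>
      contributes only its constant term.\<close>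
    moreover have "(a, \<lambda>_. 0) \<in> msplits n a"
      using a by (simp add: msplits_def)
    ultimately have "f a \<otimes> g (\<lambda>_. 0) = \<zero>"
      by (metis (no_types, lifting) finsum_eq_zeroD[OF finite_msplits] fst_conv snd_conv)
    \<comment> \<open>Multiplying on the right by the constant term of \<open>f\<close>, which is
      inverse to that of \<open>g\<close>, will leave \<open>f a\<close> alone.\<close>
    then have "f a \<otimes> (g (\<lambda>_. 0) \<otimes> f (\<lambda>_. 0)) = \<zero>"
      using fa f0 g0 by (simp flip: m_assoc)
    then show ?thesis
      using fg0 fa f0 g0 by (simp add: m_comm)
  qed
  then show "f = mps_const S n (f (\<lambda>_. 0))"
    using f f0 by (intro mps_eqI[of _ n]) (auto simp: mps_const_coeff)
qed

theorem theorem6p8: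
  fixes S :: "('a, 'm) ring_scheme" and n :: nat
  assumes "zerosumfree_semiring S"
  shows "Units (mps S n) = mps_const S n ` Units S"
proof -
  interpret zerosumfree_semiring S by fact
  show ?thesis
  proof (intro equalityI subsetI)
    fix f assume "f \<in> Units (mps S n)"
    then obtain g where fg: "f \<in> carrier (mps S n)" "g \<in> carrier (mps S n)"
      "f \<otimes>\<^bsub>mps S n\<^esub> g = \<one>\<^bsub>mps S n\<^esub>"
      by (auto simp: Units_def mps_mult_comm)
    have "f (\<lambda>_. 0) \<in> carrier S" "g (\<lambda>_. 0) \<in> carrier S"
      using fg by simp_all
    \<comment> \<open>\<open>Units\<close> asks for a two-sided inverse; commutativity supplies the
      second equation.\<close>
    then have "f (\<lambda>_. 0) \<in> Units S"
      using mps_unit_is_const(1)[OF fg] m_comm[of "f (\<lambda>_. 0)" "g (\<lambda>_. 0)"]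
      unfolding Units_def by auto
    then show "f \<in> mps_const S n ` Units S"
      using mps_unit_is_const(2)[OF fg] by blast
  next
    fix f assume "f \<in> mps_const S n ` Units S"
    then obtain s t where st: "f = mps_const S n s" "s \<in> carrier S" "t \<in> carrier S"
      "s \<otimes>\<^bsub>S\<^esub> t = \<one>\<^bsub>S\<^esub>" "t \<otimes>\<^bsub>S\<^esub> s = \<one>\<^bsub>S\<^esub>"
      by (auto simp: Units_def)
    \<comment> \<open>The embedding of constants is a homomorphism, so it carries both inverse
      equations for \<open>s\<close> and \<open>t\<close> over to the power series.\<close>
    have "mps_const S n s \<otimes>\<^bsub>mps S n\<^esub> mps_const S n t = \<one>\<^bsub>mps S n\<^esub>"
      "mps_const S n t \<otimes>\<^bsub>mps S n\<^esub> mps_const S n s = \<one>\<^bsub>mps S n\<^esub>"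
      using st by (simp_all add: mps_one flip: ring_hom_mult[OF mps_const_hom])
    then show "f \<in> Units (mps S n)"
      using st mps_const_closed unfolding Units_def by blast
  qed
qed

end
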